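(* Let $Q\ge2$, $\kappa\ge1$, and let $\mathbf p_{ql}=\mathbf p_{lq}=(p_{ql}(1),\dots,p_{ql}(\kappa))$, $1\le q\le l\le Q$, be probability vectors that are linearly independent in $\mathbb R^\kappa$. Let $A$ be the $Q^3\times\kappa^3$ matrix with rows indexed by $(z_1,z_2,z_3)\in\{1,\dots,Q\}^3$, columns indexed by $(x_{12},x_{13},x_{23})\in\{1,\dots,\kappa\}^3$, and entries $$A_{(z_1,z_2,z_3),(x_{12},x_{13},x_{23})}=p_{z_1z_2}(x_{12})\,p_{z_1z_3}(x_{13})\,p_{z_2z_3}(x_{23}).$$ Then $A$ has full row rank $Q^3$.
   Context: In the $\kappa$-state random graph mixture model, $A$ is the matrix of conditional probabilities of the edge states on the complete graph on $3$ nodes given the latent groups of the $3$ nodes, with $p_{ql}(k)=\mathbb P(X_{ij}=k\mid Z_i=q,Z_j=l)$. *)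

theory Defs
  imports "HOL-Analysis.Analysis"
begin

text \<open>The latent groups {1..Q} are represented by a finite type 'q (Q = CARD('q)),
  the edge states {1..kappa} by a finite type 'k (kappa = CARD('k)).
  p q l is the probability vector p_{ql} in real^'k.\<close>

definition mixture_matrix ::
  "('q::finite \<Rightarrow> 'q \<Rightarrow> real^'k::finite) \<Rightarrow> real^('k \<times> 'k \<times> 'k)^('q \<times> 'q \<times> 'q)" where
  "mixture_matrix p = vec_lambda (\<lambda>(z1, z2, z3). vec_lambda (\<lambda>(x12, x13, x23).
      (p z1 z2 $ x12) * (p z1 z3 $ x13) * (p z2 z3 $ x23)))"

end

theory Submission
  imports Defs
begin

text \<open>
  Since the vectors p_ql are linearly independent, there is a dual family:
  vectors w(p_ql) with p_q'l' \<bullet> w(p_ql) = 1 if {q',l'} = {q,l} and 0 otherwise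
  (coordinate functionals of a basis extending the p_ql, represented by inner products).
  Applying A to the tensor w(p_ab) \<otimes> w(p_ad) \<otimes> w(p_bd) factorises row by row into
  three inner products, and a row (z1,z2,z3) survives only if {z1,z2} = {a,b},
  {z1,z3} = {a,d} and {z2,z3} = {b,d}, i.e. only if (z1,z2,z3) = (a,b,d).
  Hence every standard basis vector lies in the column space of A, so A is surjective
  and has full row rank.
\<close>

lemma independent_dual_family:
  fixes S :: "'a::euclidean_space set"
  assumes "independent S"
  obtains w :: "'a \<Rightarrow> 'a"
    where "\<And>s t. s \<in> S \<Longrightarrow> t \<in> S \<Longrightarrow> s \<bullet> w t = (if s = t then 1 else 0)"
proof
  define B where "B = extend_basis S"
  have SB: "S \<subseteq> B" and indB: "independent B" and spanB: "span B = UNIV"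
    using assms by (auto simp: B_def extend_basis_superset independent_extend_basis)
  define w where "w t = adjoint (\<lambda>v. representation B v t) (1::real)" for t
  have lin: "linear (\<lambda>v. representation B v t)" for t
    by (rule linearI) (simp_all add: representation_add representation_scale indB spanB)
  fix s t assume "s \<in> S" "t \<in> S"
  have "s \<bullet> w t = representation B s t"
    using adjoint_works[OF lin] by (simp add: w_def)
  also have "\<dots> = (if s = t then 1 else 0)"
    using representation_basis[OF indB] SB \<open>s \<in> S\<close> by auto
  finally show "s \<bullet> w t = (if s = t then 1 else 0)" .
qed

definition tensor3 :: "'a::times^'k \<Rightarrow> 'a^'k \<Rightarrow> 'a^'k \<Rightarrow> 'a^('k \<times> 'k \<times> 'k)" where
  "tensor3 u v w = vec_lambda (\<lambda>(x1, x2, x3). u $ x1 * v $ x2 * w $ x3)"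

lemma sum_triple_product:
  fixes f :: "'a \<Rightarrow> 'd::comm_semiring_1" and g :: "'b \<Rightarrow> 'd" and h :: "'c \<Rightarrow> 'd"
  shows "(\<Sum>(x, y, z)\<in>A \<times> B \<times> C. f x * g y * h z) = sum f A * sum g B * sum h C"
proof -
  have "sum f A * sum g B * sum h C = (\<Sum>x\<in>A. \<Sum>y\<in>B. \<Sum>z\<in>C. f x * g y * h z)"
    by (simp add: sum_distrib_left[symmetric] sum_distrib_right[symmetric] mult.assoc)
  also have "\<dots> = (\<Sum>(x, y, z)\<in>A \<times> B \<times> C. f x * g y * h z)"
    by (simp add: sum.cartesian_product case_prod_unfold)
  finally show ?thesis by simp
qed

lemma mixture_matrix_tensor3:
  fixes p :: "'q::finite \<Rightarrow> 'q \<Rightarrow> real^'k::finite"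
  shows "(mixture_matrix p *v tensor3 u v w) $ (z1, z2, z3)
           = (p z1 z2 \<bullet> u) * (p z1 z3 \<bullet> v) * (p z2 z3 \<bullet> w)"
proof -
  have "(mixture_matrix p *v tensor3 u v w) $ (z1, z2, z3)
      = (\<Sum>(x1, x2, x3)\<in>UNIV \<times> UNIV \<times> UNIV.
           (p z1 z2 $ x1 * u $ x1) * (p z1 z3 $ x2 * v $ x2) * (p z2 z3 $ x3 * w $ x3))"
    by (simp add: matrix_vector_mult_def mixture_matrix_def tensor3_def case_prod_unfold
        UNIV_Times_UNIV ac_simps)
  also have "\<dots> = (p z1 z2 \<bullet> u) * (p z1 z3 \<bullet> v) * (p z2 z3 \<bullet> w)"
    by (simp only: sum_triple_product inner_vec_def inner_real_def)
  finally show ?thesis .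
qed

lemma triangle_edges_determine_vertices:
  "({z1, z2} = {a, b} \<and> {z1, z3} = {a, d} \<and> {z2, z3} = {b, d})
     \<longleftrightarrow> (z1, z2, z3) = (a, b, d)"
  by (auto simp: doubleton_eq_iff)

lemma surj_matrix_if_axes_in_range:
  fixes A :: "real^'n^'m"
  assumes "\<And>i. \<exists>x. A *v x = axis i 1"
  shows "surj ((*v) A)"
proof -
  obtain x where x: "\<And>i. A *v x i = axis i 1"
    using assms by (metis choice)
  show ?thesis
  proof (rule surjI)
    fix y :: "real^'m"
    have "A *v (\<Sum>i\<in>UNIV. y $ i *\<^sub>R x i) = (\<Sum>i\<in>UNIV. y $ i *\<^sub>R (A *v x i))"
      by (simp add: linear_sum linear_scale)
    also have "\<dots> = y"
      using basis_expansion[of y] by (simp add: x scalar_mult_eq_scaleR)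
    finally show "A *v (\<Sum>i\<in>UNIV. y $ i *\<^sub>R x i) = y" .
  qed
qed

theorem lemma5:
  fixes p :: "'q::finite \<Rightarrow> 'q \<Rightarrow> real^'k::finite"
  assumes Q2: "CARD('q) \<ge> 2"
    and sym: "\<And>q l. p q l = p l q"
    and prob_nonneg: "\<And>q l k. p q l $ k \<ge> 0"
    and prob_sum: "\<And>q l. (\<Sum>k\<in>UNIV. p q l $ k) = 1"
    and distinct: "\<And>q l q' l'. p q l = p q' l' \<Longrightarrow> {q, l} = {q', l'}"
    and indep: "independent (range (\<lambda>(q, l). p q l))"
  shows "rank (mixture_matrix p) = CARD('q) ^ 3"
proof -
  obtain w where w: "\<And>s t. s \<in> range (\<lambda>(q, l). p q l) \<Longrightarrow> t \<in> range (\<lambda>(q, l). p q l)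
      \<Longrightarrow> s \<bullet> w t = (if s = t then 1 else 0)"
    using independent_dual_family[OF indep] by blast
  have dual: "p q l \<bullet> w (p q' l') = (if {q, l} = {q', l'} then 1 else 0)" for q l q' l'
  proof -
    have "p q l = p q' l' \<longleftrightarrow> {q, l} = {q', l'}"
      using distinct sym by (metis doubleton_eq_iff)
    moreover have "p q l \<in> range (\<lambda>(q, l). p q l)" "p q' l' \<in> range (\<lambda>(q, l). p q l)"
      by (auto intro: range_eqI[where x = "(q, l)"] range_eqI[where x = "(q', l')"])
    ultimately show ?thesis
      using w by simp
  qed
  have axis_in_range: "mixture_matrix p *v tensor3 (w (p a b)) (w (p a d)) (w (p b d))
      = axis (a, b, d) 1" for a b d
  proof (rule vec_eq_iff[THEN iffD2, rule_format])
    fix z :: "'q \<times> 'q \<times> 'q"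
    obtain z1 z2 z3 where z: "z = (z1, z2, z3)" by (cases z)
    have "(mixture_matrix p *v tensor3 (w (p a b)) (w (p a d)) (w (p b d))) $ z
        = (if {z1, z2} = {a, b} \<and> {z1, z3} = {a, d} \<and> {z2, z3} = {b, d} then 1 else 0)"
      by (simp add: z mixture_matrix_tensor3 dual)
    also have "\<dots> = axis (a, b, d) 1 $ z"
      unfolding triangle_edges_determine_vertices by (simp add: z axis_def)
    finally show "(mixture_matrix p *v tensor3 (w (p a b)) (w (p a d)) (w (p b d))) $ z
        = axis (a, b, d) 1 $ z" .
  qed
  have "surj ((*v) (mixture_matrix p))"
    by (intro surj_matrix_if_axes_in_range) (metis axis_in_range prod_cases3)
  then have "rank (mixture_matrix p) = CARD('q \<times> 'q \<times> 'q)"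
    by (simp only: full_rank_surjective)
  then show ?thesis
    by (simp add: power3_eq_cube)
qed

end
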